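(* Let $\beta>0$ and suppose $\hat x$ is a global minimizer of the problem $$\min_{x\in\mathcal Y}\ \mathcal G_\beta(x)=\gamma\|x\|_D-\mathfrak r^\top x+\beta\|x\|_0,\qquad \mathcal Y=\{x\in\mathbb R^N:\|x\|_D\le T\}.$$ If $\hat\sigma=\{i:\hat x[i]\neq0\}$ denotes the support of $\hat x$, then for every $i\in\hat\sigma$, $$|\hat x[i]|\ge\min\left\{\frac{\beta}{|\mathfrak r[i]|+H\sqrt{D_{ii}}},\ \frac{T}{\sqrt{D_{ii}}}\right\},$$ where $H=\sqrt{\mathfrak r^\top D^{-1}\mathfrak r}$.
   Context: Data: $N\ge 1$; $D\in\mathbb R^{N\times N}$ is a symmetric positive definite matrix with diagonal entries $D_{ii}$; $\hat r\in\mathbb R^N$; $r_c\in\mathbb R$; $\gamma>0$; $T>0$. Set $\mathfrak r=\hat r-r_c\mathbf 1\in\mathbb R^N$ (with entries $\mathfrak r[i]$, where $\mathbf 1$ is the all-ones vector). Notation: $\|x\|_D=\sqrt{x^\top D x}$; $\|x\|_0$ is the number of nonzero entries of $x$. Standing assumptions: $\min_{1\le i\le N}|\mathfrak r[i]|/\sqrt{D_{ii}}>\gamma$, and $T>\min_{1\le i\le N}\dfrac{\sqrt{D_{ii}}\,\beta}{|\mathfrak r[i]|-\sqrt{D_{ii}}\,\gamma}$. *)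

theory Defs
  imports "HOL-Analysis.Analysis"
begin

definition sym_pos_def :: "real ^ 'n ^ 'n \<Rightarrow> bool" where
  "sym_pos_def D \<longleftrightarrow> transpose D = D \<and> (\<forall>x. x \<noteq> 0 \<longrightarrow> 0 < x \<bullet> (D *v x))"

definition mat_norm :: "real ^ 'n ^ 'n \<Rightarrow> real ^ 'n \<Rightarrow> real" where
  "mat_norm D x = sqrt (x \<bullet> (D *v x))"

definition vec_support :: "real ^ 'n \<Rightarrow> 'n set" where
  "vec_support x = {i. x $ i \<noteq> 0}"

definition l0_norm :: "real ^ 'n \<Rightarrow> nat" where
  "l0_norm x = card (vec_support x)"

definition sparse_objective ::
    "real ^ 'n ^ 'n \<Rightarrow> real ^ 'n \<Rightarrow> real \<Rightarrow> real \<Rightarrow> real ^ 'n \<Rightarrow> real" where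
  "sparse_objective D r \<gamma> \<beta> x = \<gamma> * mat_norm D x - r \<bullet> x + \<beta> * real (l0_norm x)"

definition feasible_set :: "real ^ 'n ^ 'n \<Rightarrow> real \<Rightarrow> (real ^ 'n) set" where
  "feasible_set D T = {x. mat_norm D x \<le> T}"

end

theory Submission
  imports Defs
begin

text \<open>
  Fix an index \<open>i\<close> in the support of the minimizer \<open>xhat\<close>. The natural competitor is
  \<open>y\<close>, obtained from \<open>xhat\<close> by erasing entry \<open>i\<close>: it saves the penalty \<open>\<beta>\<close>, so by
  minimality the rest of the objective must grow by at least \<open>\<beta>\<close>. Erasing the entry moves
  the \<open>D\<close>-norm by at most \<open>d = \<bar>xhat $ i\<bar> * sqrt (D $ i $ i)\<close>, the norm of the removed part.

  In a non-diagonal geometry the erasure may however increase the norm and push \<open>y\<close> out of the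
  feasible ball. In that case \<open>y\<close> is pulled back radially to \<open>z = s y\<close> on the sphere of
  radius \<open>T\<close>, which creates no new nonzero entry. The pull-back has length at most \<open>d\<close>, because
  \<open>xhat\<close> itself lies in the ball, and changes the linear term by at most \<open>H\<close> times that
  length: \<open>H\<close> is the norm of the functional \<open>r\<close> dual to the \<open>D\<close>-norm
  (lemma \<open>abs_inner_le_dual_mat_norm\<close>). Comparing \<open>xhat\<close> with \<open>z\<close>,
  where \<open>z = y\<close> if \<open>y\<close> is feasible, gives
  \<open>\<beta> \<le> \<gamma> (\<parallel>z\<parallel> - \<parallel>xhat\<parallel>) + r $ i * xhat $ i + H (\<parallel>y\<parallel> - \<parallel>z\<parallel>)\<close>. As the entries of \<open>r\<close> are
  large, testing the dual norm on a coordinate vector gives \<open>\<gamma> < H\<close>, so the right-hand side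
  is at most \<open>\<bar>xhat $ i\<bar> (\<bar>r $ i\<bar> + H * sqrt (D $ i $ i))\<close>. This is the first of the two
  bounds in the minimum.
\<close>

section \<open>The norm of a positive definite matrix\<close>

lemma sym_pos_def_inner_commute:
  assumes "sym_pos_def D"
  shows "x \<bullet> (D *v y) = y \<bullet> (D *v x)"
proof -
  have "x \<bullet> (D *v y) = (transpose D *v x) \<bullet> y"
    by (simp add: dot_lmul_matrix)
  moreover have "transpose D = D"
    using assms by (simp add: sym_pos_def_def)
  ultimately show ?thesis
    by (simp only: inner_commute)
qed

lemma sym_pos_def_nonneg:
  assumes "sym_pos_def D"
  shows "0 \<le> x \<bullet> (D *v x)"
  using assms by (cases "x = 0") (auto simp: sym_pos_def_def less_imp_le)

lemma mat_norm_nonneg: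
  assumes "sym_pos_def D"
  shows "0 \<le> mat_norm D x"
  by (simp add: mat_norm_def sym_pos_def_nonneg[OF assms])

lemma mat_norm_square:
  assumes "sym_pos_def D"
  shows "(mat_norm D x)\<^sup>2 = x \<bullet> (D *v x)"
  by (simp add: mat_norm_def sym_pos_def_nonneg[OF assms])

lemma mat_norm_scaleR:
  "mat_norm D (c *\<^sub>R x) = \<bar>c\<bar> * mat_norm D x"
proof -
  have "(c *\<^sub>R x) \<bullet> (D *v (c *\<^sub>R x)) = c\<^sup>2 * (x \<bullet> (D *v x))"
    by (simp add: matrix_vector_mult_scaleR power2_eq_square)
  then show ?thesis
    by (simp add: mat_norm_def real_sqrt_mult)
qed

lemma mat_norm_axis:
  "mat_norm D (axis i c) = \<bar>c\<bar> * sqrt (D $ i $ i)"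
proof -
  have "mat_norm D (axis i 1) = sqrt (D $ i $ i)"
    by (simp add: mat_norm_def matrix_vector_mult_basis column_def inner_axis')
  moreover have "axis i c = c *\<^sub>R axis i 1"
    by (simp add: vec_eq_iff axis_def)
  ultimately show ?thesis
    by (simp add: mat_norm_scaleR)
qed

lemma sym_pos_def_diag_pos:
  assumes "sym_pos_def D"
  shows "0 < D $ i $ i"
proof -
  have "0 < axis i 1 \<bullet> (D *v axis i 1)"
    using assms by (simp add: sym_pos_def_def)
  then show ?thesis
    by (simp add: matrix_vector_mult_basis column_def inner_axis')
qed

text \<open>
  Positivity of the form at the single vector \<open>b x - a y\<close>, where \<open>a\<close> and \<open>b\<close> are the
  \<open>D\<close>-norms of \<open>x\<close> and \<open>y\<close>, is the inequality multiplied by \<open>2 a b\<close>. By definiteness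
  \<open>a b = 0\<close> only if one of the vectors is zero.
\<close>

lemma mat_Cauchy_Schwarz:
  assumes "sym_pos_def D"
  shows "x \<bullet> (D *v y) \<le> mat_norm D x * mat_norm D y"
proof (cases "x = 0 \<or> y = 0")
  case True
  then show ?thesis by (auto simp: mat_norm_def)
next
  case False
  define a b where "a = mat_norm D x" and "b = mat_norm D y"
  have pos: "0 < a" "0 < b"
    using assms False by (auto simp: a_def b_def mat_norm_def sym_pos_def_def)
  have "0 \<le> (b *\<^sub>R x - a *\<^sub>R y) \<bullet> (D *v (b *\<^sub>R x - a *\<^sub>R y))"
    by (rule sym_pos_def_nonneg[OF assms])
  also have "\<dots> = b\<^sup>2 * (x \<bullet> (D *v x)) - 2 * a * b * (x \<bullet> (D *v y)) + a\<^sup>2 * (y \<bullet> (D *v y))"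
    using sym_pos_def_inner_commute[OF assms, of y x]
    by (simp add: matrix_vector_mult_diff_distrib matrix_vector_mult_scaleR inner_diff_left
        inner_diff_right power2_eq_square algebra_simps)
  also have "\<dots> = (2 * a * b) * (a * b - x \<bullet> (D *v y))"
    unfolding mat_norm_square[OF assms, symmetric] a_def b_def
    by (simp add: power2_eq_square algebra_simps)
  finally have "0 \<le> (2 * a * b) * (a * b - x \<bullet> (D *v y))" .
  moreover have "0 < 2 * a * b"
    using pos by simp
  ultimately have "0 \<le> a * b - x \<bullet> (D *v y)"
    by (metis mult_pos_neg not_less)
  then show ?thesis
    by (simp add: a_def b_def)
qed

lemma mat_norm_triangle_ineq:
  assumes "sym_pos_def D"
  shows "mat_norm D (x + y) \<le> mat_norm D x + mat_norm D y"
proof (rule power2_le_imp_le)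
  have "(mat_norm D (x + y))\<^sup>2
      = (mat_norm D x)\<^sup>2 + 2 * (x \<bullet> (D *v y)) + (mat_norm D y)\<^sup>2"
    using sym_pos_def_inner_commute[OF assms, of y x]
    by (simp add: mat_norm_square[OF assms] matrix_vector_right_distrib inner_add_left
        inner_add_right)
  also have "\<dots> \<le> (mat_norm D x + mat_norm D y)\<^sup>2"
    using mat_Cauchy_Schwarz[OF assms, of x y] by (simp add: power2_sum)
  finally show "(mat_norm D (x + y))\<^sup>2 \<le> (mat_norm D x + mat_norm D y)\<^sup>2" .
qed (simp add: mat_norm_nonneg[OF assms])

section \<open>The dual norm\<close>

lemma sym_pos_def_matrix_inv:
  assumes "sym_pos_def D"
  shows "D ** matrix_inv D = mat 1"
proof -
  have "x = 0" if "D *v x = 0" for x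
    using assms that unfolding sym_pos_def_def by (metis inner_zero_right less_irrefl)
  then have "invertible D"
    by (simp add: invertible_left_inverse matrix_left_invertible_ker)
  then have "D ** matrix_inv D = mat 1 \<and> matrix_inv D ** D = mat 1"
    unfolding invertible_def matrix_inv_def by (rule someI_ex)
  then show ?thesis ..
qed

text \<open>
  The inverse matrix represents \<open>r\<close> in the inner product given by \<open>D\<close>: for \<open>w = D\<inverse> r\<close> one
  has \<open>r \<bullet> v = v \<bullet> D w\<close>, and \<open>w\<close> has \<open>D\<close>-norm \<open>sqrt (r \<bullet> D\<inverse> r)\<close>, so this is
  the Cauchy-Schwarz inequality for \<open>D\<close>.
\<close>

lemma abs_inner_le_dual_mat_norm:
  assumes "sym_pos_def D"
  shows "\<bar>r \<bullet> v\<bar> \<le> sqrt (r \<bullet> (matrix_inv D *v r)) * mat_norm D v"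
proof -
  define w where "w = matrix_inv D *v r"
  have Dw: "D *v w = r"
    using sym_pos_def_matrix_inv[OF assms]
    by (simp add: w_def matrix_vector_mul_assoc)
  have bound: "r \<bullet> u \<le> sqrt (r \<bullet> w) * mat_norm D u" for u
    using mat_Cauchy_Schwarz[OF assms, of u w]
    by (simp add: Dw mat_norm_def inner_commute mult.commute)
  have "mat_norm D (- v) = mat_norm D v"
    using mat_norm_scaleR[of D "-1" v] by simp
  then show ?thesis
    using bound[of v] bound[of "- v"] by (simp add: w_def abs_le_iff)
qed

lemma abs_entry_le_dual_mat_norm:
  assumes "sym_pos_def D"
  shows "\<bar>r $ i\<bar> \<le> sqrt (r \<bullet> (matrix_inv D *v r)) * sqrt (D $ i $ i)"
  using abs_inner_le_dual_mat_norm[OF assms, of r "axis i 1"]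
  by (simp add: mat_norm_axis inner_axis)

section \<open>Erasing an entry and returning to the ball\<close>

lemma l0_norm_erase_entry:
  assumes "i \<in> vec_support x"
  shows "real (l0_norm (c *\<^sub>R (x - axis i (x $ i)))) \<le> real (l0_norm x) - 1"
proof -
  have "vec_support (c *\<^sub>R (x - axis i (x $ i))) \<subseteq> vec_support x - {i}"
    by (auto simp: vec_support_def axis_def split: if_splits)
  then have "l0_norm (c *\<^sub>R (x - axis i (x $ i))) \<le> card (vec_support x - {i})"
    unfolding l0_norm_def by (intro card_mono) auto
  moreover have "card (vec_support x) = Suc (card (vec_support x - {i}))"
    using assms by (intro card_Suc_Diff1[symmetric]) auto
  ultimately show ?thesis
    by (simp add: l0_norm_def)
qed

lemma radial_retraction_to_ball:
  assumes "sym_pos_def D" and "0 < T"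
  obtains s where "0 \<le> s" "s \<le> 1" "mat_norm D (s *\<^sub>R y) = min (mat_norm D y) T"
proof (cases "mat_norm D y \<le> T")
  case True
  then show ?thesis
    using that[of 1] by simp
next
  case False
  then show ?thesis
    using that[of "T / mat_norm D y"] \<open>0 < T\<close> by (simp add: mat_norm_scaleR)
qed

text \<open>
  Write \<open>y\<close> for \<open>x\<close> with entry \<open>i\<close> erased and \<open>z\<close> for its retraction to the ball.
  Moving from \<open>y\<close> to \<open>z\<close> trades a growth of the norm, of cost \<open>\<gamma>\<close> per unit, for a change
  of the linear term, of cost at most \<open>H\<close> per unit. Under the condition \<open>\<gamma> \<le> H\<close> the worst
  case charges the whole norm \<open>d\<close> of the erased part at rate \<open>H\<close>.
\<close>

lemma minimizer_entry_bound:
  fixes D :: "real ^ 'n ^ 'n"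
  defines "H r \<equiv> sqrt (r \<bullet> (matrix_inv D *v r))"
  assumes spd: "sym_pos_def D" and "0 \<le> \<gamma>" "\<gamma> \<le> H r" "0 < T" "0 \<le> \<beta>"
    and min: "is_arg_min (sparse_objective D r \<gamma> \<beta>) (\<lambda>x. x \<in> feasible_set D T) x"
    and i: "i \<in> vec_support x"
  shows "\<beta> \<le> \<bar>x $ i\<bar> * (\<bar>r $ i\<bar> + H r * sqrt (D $ i $ i))"
proof -
  define d where "d = \<bar>x $ i\<bar> * sqrt (D $ i $ i)"
  define y where "y = x - axis i (x $ i)"
  obtain s where s: "0 \<le> s" "s \<le> 1" and norm_sy: "mat_norm D (s *\<^sub>R y) = min (mat_norm D y) T"
    using radial_retraction_to_ball[OF spd \<open>0 < T\<close>] .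
  define z where "z = s *\<^sub>R y"
  have norm_z: "mat_norm D z = min (mat_norm D y) T"
    by (simp add: z_def norm_sy)

  have "z \<in> feasible_set D T"
    by (simp add: feasible_set_def norm_z)
  then have "sparse_objective D r \<gamma> \<beta> x \<le> sparse_objective D r \<gamma> \<beta> z"
    using min by (auto simp: is_arg_min_def not_less)
  moreover have "\<beta> * real (l0_norm z) \<le> \<beta> * (real (l0_norm x) - 1)"
    unfolding z_def y_def using l0_norm_erase_entry[OF i] \<open>0 \<le> \<beta>\<close> by (rule mult_left_mono)
  ultimately have "\<beta> \<le> \<gamma> * (mat_norm D z - mat_norm D x) + r \<bullet> (x - y) + r \<bullet> (y - z)"
    by (simp add: sparse_objective_def inner_diff_right algebra_simps)
  moreover have "r \<bullet> (x - y) \<le> \<bar>x $ i\<bar> * \<bar>r $ i\<bar>"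
    by (simp add: y_def inner_axis abs_mult[symmetric] mult.commute)
  moreover have "r \<bullet> (y - z) \<le> H r * (mat_norm D y - mat_norm D z)"
  proof -
    have "y - z = (1 - s) *\<^sub>R y"
      by (simp add: z_def algebra_simps)
    then have "mat_norm D (y - z) = (1 - s) * mat_norm D y"
      using s by (simp add: mat_norm_scaleR)
    also have "\<dots> = mat_norm D y - mat_norm D z"
      using s by (simp add: z_def mat_norm_scaleR left_diff_distrib)
    finally have "mat_norm D (y - z) = mat_norm D y - mat_norm D z" .
    then show ?thesis
      using abs_inner_le_dual_mat_norm[OF spd, of r "y - z"] by (simp add: H_def)
  qed
  moreover have "\<gamma> * (mat_norm D z - mat_norm D x) + H r * (mat_norm D y - mat_norm D z) \<le> H r * d"
  proof -
    have "y = x + axis i (- (x $ i))"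
      by (simp add: y_def vec_eq_iff axis_def)
    then have erase: "mat_norm D y \<le> mat_norm D x + d"
      using mat_norm_triangle_ineq[OF spd, of x "axis i (- (x $ i))"]
      by (simp add: mat_norm_axis d_def)
    have "mat_norm D x \<le> T"
      using min by (simp add: is_arg_min_def feasible_set_def)
    moreover have "0 \<le> d"
      using sym_pos_def_diag_pos[OF spd, of i] by (simp add: d_def)
    ultimately have retract: "mat_norm D y - mat_norm D z \<le> d"
      using erase by (simp add: norm_z min_def)
    \<comment> \<open>Regrouped so that both coefficients are nonnegative and both differences are at most
      \<open>d\<close>.\<close>
    have "\<gamma> * (mat_norm D z - mat_norm D x) + H r * (mat_norm D y - mat_norm D z)
        = \<gamma> * (mat_norm D y - mat_norm D x) + (H r - \<gamma>) * (mat_norm D y - mat_norm D z)"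
      by (simp add: algebra_simps)
    also have "\<dots> \<le> \<gamma> * d + (H r - \<gamma>) * d"
      using erase retract \<open>0 \<le> \<gamma>\<close> \<open>\<gamma> \<le> H r\<close>
      by (intro add_mono mult_left_mono) auto
    finally show ?thesis
      by (simp add: algebra_simps)
  qed
  ultimately have "\<beta> \<le> \<bar>x $ i\<bar> * \<bar>r $ i\<bar> + H r * d"
    by linarith
  then show ?thesis
    by (simp add: d_def algebra_simps)
qed

theorem theorem3:
  fixes D :: "real ^ 'n ^ 'n"
    and rhat r xhat :: "real ^ 'n"
    and r\<^sub>c \<gamma> \<beta> T H :: real
  assumes "sym_pos_def D"
    and "\<gamma> > 0"
    and "T > 0"
    and "\<beta> > 0"
    and "r = rhat - r\<^sub>c *\<^sub>R (\<chi> i. 1)"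
    and "H = sqrt (r \<bullet> (matrix_inv D *v r))"
    and "Min (range (\<lambda>i. \<bar>r $ i\<bar> / sqrt (D $ i $ i))) > \<gamma>"
    and "T > Min (range (\<lambda>i. sqrt (D $ i $ i) * \<beta> / (\<bar>r $ i\<bar> - sqrt (D $ i $ i) * \<gamma>)))"
    and "is_arg_min (sparse_objective D r \<gamma> \<beta>) (\<lambda>x. x \<in> feasible_set D T) xhat"
  shows "\<forall>i \<in> vec_support xhat.
           \<bar>xhat $ i\<bar> \<ge> min (\<beta> / (\<bar>r $ i\<bar> + H * sqrt (D $ i $ i))) (T / sqrt (D $ i $ i))"
proof
  fix i assume i: "i \<in> vec_support xhat"
  have diag: "0 < sqrt (D $ i $ i)"
    using sym_pos_def_diag_pos[OF assms(1)] by simp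
  have "\<gamma> < \<bar>r $ i\<bar> / sqrt (D $ i $ i)"
    using assms(7) by simp
  also have "\<dots> \<le> H"
    using abs_entry_le_dual_mat_norm[OF assms(1), of r i] diag assms(6)
    by (simp add: pos_divide_le_eq)
  finally have "\<gamma> < H" .
  then have "\<beta> \<le> \<bar>xhat $ i\<bar> * (\<bar>r $ i\<bar> + H * sqrt (D $ i $ i))"
    using minimizer_entry_bound[OF assms(1) _ _ assms(3) _ assms(9) i] assms(2,4,6) by simp
  moreover have "0 < \<bar>r $ i\<bar> + H * sqrt (D $ i $ i)"
    using diag \<open>\<gamma> < H\<close> \<open>\<gamma> > 0\<close> by (simp add: add_nonneg_pos)
  ultimately have "\<beta> / (\<bar>r $ i\<bar> + H * sqrt (D $ i $ i)) \<le> \<bar>xhat $ i\<bar>"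
    by (simp add: pos_divide_le_eq)
  then show "\<bar>xhat $ i\<bar> \<ge> min (\<beta> / (\<bar>r $ i\<bar> + H * sqrt (D $ i $ i))) (T / sqrt (D $ i $ i))"
    by (rule min.coboundedI1)
qed

end
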